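(* Let $n\ge2$ be even. The Newton polynomial in $z$ for the strip of squares with $n$ black nodes on the torus is $$\mathcal P_n^{\mathrm{sq}}(z)=z^{-n/2}\sum_{p=0}^n(-1)^p z^p\,b_{n,p}=z^{-n/2}\sum_{p=0}^n(-1)^pz^p\sum_{q=0}^p\frac{n\,(n-q-1)!}{q!\,(p-q)!\,(n-q-p)!},$$ where $b_{n,p}$ is the number of perfect matchings of the strip with $z$-weight $n/2-p$ (and $w$-weight $0$), and terms with $q>n-p$ are read as $0$.
   Context: Strip of squares. For even $n\ge2$, the strip of squares $\mathcal G_{2,n}$ on the torus is the multigraph with $2n$ nodes $(r,j)$, $r\in\mathbb Z/2$ (row; $r=0$ bottom, $r=1$ top), $j\in\mathbb Z/n$ (column). Node $(r,j)$ is black if $r+j$ is even and white otherwise, so there are $n$ black nodes. There are $4n$ distinct edges (parallel edges count as different): horizontal edges $h_{r,j}$ joining $(r,j)$ and $(r,j+1)$, and vertical edges $v_{r,j}$ joining $(r,j)$ and $(r+1,j)$, where $v_{r,j}$ is thought of as going upwards from $(r,j)$; thus $v_{0,j}$ is internal and $v_{1,j}$ crosses the cycle $z$ of the torus. Weights. A perfect matching is a set of edges touching each node exactly once. Edges are directed from black to white. The $z$-weight $n_z$ of a matching $M$ is the sum over edges $v_{1,j}\in M$ of $+1$ if $(1,j)$ is black and $-1$ if $(1,j)$ is white. The $w$-weight $n_w$ of $M$ is the sum over edges $h_{r,n-1}\in M$ (those crossing the cycle $w$) of $+1$ if $(r,n-1)$ is black and $-1$ if $(r,n-1)$ is white. The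 weight of $M$ is the pair $(n_z,n_w)$. Partition functions. The full partition function (Newton polynomial) is $\sum_{n_z,n_w}N_{n_z,n_w}(-1)^{n_z+n_w+n_zn_w}z^{n_z}w^{n_w}$, where $N_{n_z,n_w}$ is the number of perfect matchings of weight $(n_z,n_w)$. The Newton polynomial in $z$, $\mathcal P_n^{\mathrm{sq}}(z)$, is its $w^0$ part.
   Formalization: Both expressions for the Newton polynomial are multiplied by a global sign (-1)^{n/2}; without it the identity fails for n ≡ 2 mod 4 (for n=2 the definition gives -z^{-1}+4-z, while the stated right-hand side is z^{-1}-4+z). *)

theory Defs
  imports Complex_Main "HOL-Computational_Algebra.Formal_Laurent_Series"
begin

text \<open>
  Residues in Z/2 and Z/n are represented by their representatives in \<open>{..<2}\<close> and \<open>{..<n}\<close>;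
  a node is a pair (row, column).  Edges are a datatype of labels, so that parallel edges
  stay distinct: \<open>Hor r j\<close> joins \<open>(r, j)\<close> to \<open>(r, j + 1)\<close>, and \<open>Ver r j\<close> goes upwards from
  \<open>(r, j)\<close> to \<open>(r + 1, j)\<close>.
\<close>

type_synonym node = "nat \<times> nat"

datatype edge = Hor nat nat | Ver nat nat

definition nodes :: "nat \<Rightarrow> node set" where
  "nodes n = {..<2} \<times> {..<n}"

definition edges :: "nat \<Rightarrow> edge set" where
  "edges n = {Hor r j | r j. r < 2 \<and> j < n} \<union> {Ver r j | r j. r < 2 \<and> j < n}"

fun endpoints :: "nat \<Rightarrow> edge \<Rightarrow> node set" where
  "endpoints n (Hor r j) = {(r, j), (r, (j + 1) mod n)}"
| "endpoints n (Ver r j) = {(r, j), ((r + 1) mod 2, j)}"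

definition black :: "node \<Rightarrow> bool" where
  "black v \<longleftrightarrow> even (fst v + snd v)"

definition perfect_matching :: "nat \<Rightarrow> edge set \<Rightarrow> bool" where
  "perfect_matching n M \<longleftrightarrow>
     M \<subseteq> edges n \<and> (\<forall>v \<in> nodes n. \<exists>!e. e \<in> M \<and> v \<in> endpoints n e)"

text \<open>
  The signed crossing number of an edge, directed from black to white, with the cycle z
  (crossed by the \<open>Ver 1 j\<close>) and with the cycle w (crossed by the \<open>Hor r (n - 1)\<close>).
\<close>

fun z_crossing :: "edge \<Rightarrow> int" where
  "z_crossing (Hor r j) = 0"
| "z_crossing (Ver r j) = (if r = 1 then if black (r, j) then 1 else -1 else 0)"

fun w_crossing :: "nat \<Rightarrow> edge \<Rightarrow> int" where
  "w_crossing n (Hor r j) = (if j + 1 = n then if black (r, j) then 1 else -1 else 0)"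
| "w_crossing n (Ver r j) = 0"

definition weight :: "nat \<Rightarrow> edge set \<Rightarrow> int \<times> int" where
  "weight n M = ((\<Sum>e\<in>M. z_crossing e), (\<Sum>e\<in>M. w_crossing n e))"

definition num_matchings :: "nat \<Rightarrow> int \<times> int \<Rightarrow> nat" where
  "num_matchings n k = card {M. perfect_matching n M \<and> weight n M = k}"

text \<open>
  Laurent polynomials in z and w with rational coefficients are taken inside the ring of
  Laurent series in w whose coefficients are Laurent series in z: the variable w is \<open>fls_X\<close>,
  the variable z is \<open>fls_const fls_X\<close>, and the part of degree 0 in w is the
  coefficient of index 0.  The sum runs over the finitely many weights that occur.
\<close>

definition newton_polynomial :: "nat \<Rightarrow> rat fls fls" where
  "newton_polynomial n =
     (\<Sum>(nz, nw) \<in> weight n ` {M. perfect_matching n M}.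
        of_nat (num_matchings n (nz, nw)) * (-1) powi (nz + nw + nz * nw)
          * fls_const fls_X powi nz * fls_X powi nw)"

definition newton_polynomial_z :: "nat \<Rightarrow> rat fls" where
  "newton_polynomial_z n = fls_nth (newton_polynomial n) 0"

definition bnum :: "nat \<Rightarrow> nat \<Rightarrow> nat" where
  "bnum n p = num_matchings n (int (n div 2) - int p, 0)"

text \<open>
  The closed form for \<open>bnum n p\<close> is a sum of the following terms, for \<open>q \<le> p \<le> n\<close>.  The case
  distinction is needed because of truncated subtraction.
\<close>

definition bnum_term :: "nat \<Rightarrow> nat \<Rightarrow> nat \<Rightarrow> rat" where
  "bnum_term n p q =
     (if q > n - p then 0
      else of_nat n * fact (n - q - 1) / (fact q * fact (p - q) * fact (n - q - p)))"

text \<open>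
  Normalisation pitfall: the sign \<open>(-1) ^ (nz + nw + nz * nw)\<close> makes the coefficient of
  \<open>z\<^sup>0 w\<^sup>0\<close> positive.  For instance \<open>newton_polynomial_z 2\<close> is \<open>-z\<^sup>-\<^sup>1 + 4 - z\<close>.  The expression
  \<open>z powi (-n/2) * (\<Sum>p\<le>n. (-1) ^ p * z ^ p * bnum n p)\<close> instead has lowest coefficient 1
  (\<open>z\<^sup>-\<^sup>1 - 4 + z\<close> for \<open>n = 2\<close>).  The two normalisations differ by the global sign
  \<open>(-1) ^ (n div 2)\<close>, which any exact identity between them has to carry.
\<close>

end

theory Submission
  imports Defs
begin

text \<open>
  A perfect matching of w-weight 0 uses the two horizontal edges between columns \<open>j\<close> and \<open>j + 1\<close>
  either both or not at all.  The columns \<open>j\<close> where it uses both form a set of \<open>q\<close>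
  elements without cyclically consecutive ones, and there are
  \<open>n / (n - q) * ((n - q) choose q)\<close> of these; each of the remaining \<open>n - 2 * q\<close> columns freely carries
  one of two vertical edges.  As many odd as even columns remain, so the z-weight is
  \<open>n / 2 - q\<close> minus the number of columns where the vertical edge has the lower z-crossing:
  the z-weight is \<open>n / 2 - p\<close> if \<open>p - q\<close> of them do.  The symmetry of
  \<open>(n - 2 * q) choose (p - q)\<close> under \<open>p \<mapsto> n - p\<close> exchanges the two orders of the powers of z.
\<close>

section \<open>Sets without consecutive elements\<close>

text \<open>The start \<open>a\<close> is a parameter because cutting a cycle of columns open leaves
  an interval that begins at 0 or at 1.\<close>

definition sparse_sets :: "nat \<Rightarrow> nat \<Rightarrow> nat \<Rightarrow> nat set set" where
  "sparse_sets a m q = {S. S \<subseteq> {a..<a+m} \<and> (\<forall>j\<in>S. Suc j \<notin> S) \<and> card S = q}"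

lemma finite_sparse_sets: "finite (sparse_sets a m q)"
  by (rule finite_subset[of _ "Pow {a..<a+m}"]) (auto simp: sparse_sets_def)

lemma sparse_sets_finite: "S \<in> sparse_sets a m q \<Longrightarrow> finite S"
  by (auto simp: sparse_sets_def intro: finite_subset[OF _ finite_atLeastLessThan])

text \<open>Either the last point \<open>a + Suc m\<close> is absent, or it is present and forces
  \<open>a + m\<close> out, which leaves an interval shorter by two.\<close>

lemma sparse_sets_rec:
  "sparse_sets a (Suc (Suc m)) (Suc q) =
     sparse_sets a (Suc m) (Suc q) \<union> insert (a + Suc m) ` sparse_sets a m q" (is "?L = ?A \<union> ?B")
proof
  show "?L \<subseteq> ?A \<union> ?B"
  proof
    fix S assume S: "S \<in> ?L"
    have fin: "finite S" by (rule sparse_sets_finite[OF S])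
    show "S \<in> ?A \<union> ?B"
    proof (cases "a + Suc m \<in> S")
      case False
      have "S \<subseteq> {a..<a + Suc m}"
      proof
        fix x assume x: "x \<in> S"
        then have "x \<noteq> a + Suc m" using False by metis
        then show "x \<in> {a..<a + Suc m}" using S x by (fastforce simp: sparse_sets_def)
      qed
      then show ?thesis using S by (auto simp: sparse_sets_def)
    next
      case True
      have "S - {a + Suc m} \<subseteq> {a..<a + m}"
      proof
        fix x assume x: "x \<in> S - {a + Suc m}"
        then have "x \<noteq> a + m" using S True by (auto simp: sparse_sets_def)
        then show "x \<in> {a..<a + m}" using S x by (fastforce simp: sparse_sets_def)
      qed
      then have "S - {a + Suc m} \<in> sparse_sets a m q"
        using S True fin by (auto simp: sparse_sets_def)
      moreover have "S = insert (a + Suc m) (S - {a + Suc m})" using True by auto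
      ultimately show ?thesis by blast
    qed
  qed
  show "?A \<union> ?B \<subseteq> ?L"
  proof
    fix S assume "S \<in> ?A \<union> ?B"
    then show "S \<in> ?L"
    proof
      assume "S \<in> ?A"
      then show ?thesis by (force simp: sparse_sets_def)
    next
      assume "S \<in> ?B"
      then obtain S' where S': "S' \<in> sparse_sets a m q" "S = insert (a + Suc m) S'" by auto
      have "finite S'" by (rule sparse_sets_finite[OF S'(1)])
      moreover have "a + Suc m \<notin> S'" "Suc (a + Suc m) \<notin> S'"
        using S'(1) by (auto simp: sparse_sets_def)
      ultimately show ?thesis using S' by (fastforce simp: sparse_sets_def)
    qed
  qed
qed

text \<open>The two parts of \<open>sparse_sets_rec\<close> correspond to the two summands of
  Pascal's rule.\<close>

lemma card_sparse_sets: "card (sparse_sets a m q) = (m + 1 - q) choose q"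
proof (induction m arbitrary: q rule: induct_nat_012)
  case 0
  have "sparse_sets a 0 q = (if q = 0 then {{}} else {})" by (auto simp: sparse_sets_def)
  then show ?case by simp
next
  case 1
  have "sparse_sets a 1 q = (if q = 0 then {{}} else if q = 1 then {{a}} else {})"
    by (auto simp: sparse_sets_def subset_singleton_iff)
  then show ?case by (cases q) (auto simp: One_nat_def)
next
  case (ge2 m)
  show ?case
  proof (cases q)
    case 0
    have "sparse_sets a (Suc (Suc m)) 0 = {{}}"
      by (auto simp: sparse_sets_def dest: finite_subset[OF _ finite_atLeastLessThan])
    then show ?thesis using 0 by simp
  next
    case (Suc k)
    have notin: "a + Suc m \<notin> S" if "S \<in> sparse_sets a m' k'" "m' \<le> Suc m" for S m' k'
      using that by (auto simp: sparse_sets_def)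
    have inj: "inj_on (insert (a + Suc m)) (sparse_sets a m k)"
      by (rule inj_onI) (metis notin insert_ident le_SucI order_refl)
    have disj: "sparse_sets a (Suc m) (Suc k) \<inter> insert (a + Suc m) ` sparse_sets a m k = {}"
      using notin by blast
    have "card (sparse_sets a (Suc (Suc m)) q) =
        card (sparse_sets a (Suc m) (Suc k)) + card (sparse_sets a m k)"
      unfolding Suc sparse_sets_rec
      by (subst card_Un_disjoint) (simp_all only: finite_sparse_sets finite_imageI disj card_image inj)
    also have "\<dots> = ((m + 1 - k) choose Suc k) + ((m + 1 - k) choose k)"
      using ge2 by simp
    also have "\<dots> = (Suc (Suc m) + 1 - q) choose q"
    \<comment> \<open>Beyond this range truncated subtraction breaks Pascal's rule, but all three
      binomials vanish.\<close>
    proof (cases "k \<le> m + 1")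
      case True
      then have "Suc (Suc m) + 1 - q = Suc (m + 1 - k)" using Suc by simp
      then show ?thesis using Suc by simp
    qed (use Suc in auto)
    finally show ?thesis .
  qed
qed

section \<open>Cyclic sets without consecutive elements\<close>

definition cyclic_sparse_sets :: "nat \<Rightarrow> nat set set" where
  "cyclic_sparse_sets n = {S. S \<subseteq> {..<n} \<and> (\<forall>j\<in>S. (j + 1) mod n \<notin> S)}"

lemma finite_cyclic_sparse_sets: "finite (cyclic_sparse_sets n)"
  by (rule finite_subset[of _ "Pow {..<n}"]) (auto simp: cyclic_sparse_sets_def)

lemma cyclic_sparse_sets_finite: "S \<in> cyclic_sparse_sets n \<Longrightarrow> finite S"
  by (auto simp: cyclic_sparse_sets_def intro: finite_subset[OF _ finite_lessThan])

text \<open>For \<open>q < n\<close> this equals \<open>n / (n - q) * ((n - q) choose q)\<close>, a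
  coefficient of the Lucas polynomials. The case \<open>q = 0\<close> is separate because the
  truncated \<open>q - 1\<close> would add 1.\<close>

definition cyclic_sparse_count :: "nat \<Rightarrow> nat \<Rightarrow> nat" where
  "cyclic_sparse_count n q =
     ((n - q) choose q) + (if q = 0 then 0 else (n - q - 1) choose (q - 1))"

text \<open>The cycle is cut at \<open>n - 1\<close>. A set without \<open>n - 1\<close> is sparse
  on the first \<open>n - 1\<close> columns; a set with it misses 0 and \<open>n - 2\<close>, so its
  other elements form a sparse subset of \<open>{1..<n - 2}\<close>.\<close>

lemma card_cyclic_sparse_sets:
  assumes n: "n \<ge> 2"
  shows "card {S \<in> cyclic_sparse_sets n. card S = q} = cyclic_sparse_count n q"
proof -
  let ?C = "{S \<in> cyclic_sparse_sets n. card S = q}"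
  let ?A = "{S \<in> ?C. n - 1 \<notin> S}" and ?B = "{S \<in> ?C. n - 1 \<in> S}"
  have mod: "(j + 1) mod n = (if j = n - 1 then 0 else Suc j)" if "j < n" for j
    using that n by auto
  have A: "?A = sparse_sets 0 (n - 1) q"
  proof (intro set_eqI iffI)
    fix S assume "S \<in> ?A"
    then have S: "S \<subseteq> {..<n}" "\<And>j. j \<in> S \<Longrightarrow> (j + 1) mod n \<notin> S" "card S = q" "n - 1 \<notin> S"
      by (auto simp: cyclic_sparse_sets_def)
    have "S \<subseteq> {0..<0 + (n - 1)}"
    proof
      fix x assume "x \<in> S"
      then have "x < n" "x \<noteq> n - 1" using S by auto
      then show "x \<in> {0..<0 + (n - 1)}" by auto
    qed
    moreover have "Suc j \<notin> S" if "j \<in> S" for j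
    proof -
      have "j < n" "j \<noteq> n - 1" using S that by auto
      then show ?thesis using S(2)[OF that] mod[of j] by auto
    qed
    ultimately show "S \<in> sparse_sets 0 (n - 1) q" using S by (auto simp: sparse_sets_def)
  next
    fix S assume "S \<in> sparse_sets 0 (n - 1) q"
    then have S: "S \<subseteq> {..<n - 1}" "\<And>j. j \<in> S \<Longrightarrow> Suc j \<notin> S" "card S = q"
      by (auto simp: sparse_sets_def)
    have "(j + 1) mod n \<notin> S" if "j \<in> S" for j
    proof -
      have "j < n" "j \<noteq> n - 1" using S that by auto
      then show ?thesis using S(2)[OF that] mod[of j] by auto
    qed
    then show "S \<in> ?A" using S by (auto simp: cyclic_sparse_sets_def)
  qed
  have B: "?B = (if q = 0 then {} else insert (n - 1) ` sparse_sets 1 (n - 3) (q - 1))"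
  proof (intro set_eqI iffI)
    fix S assume SB: "S \<in> ?B"
    then have S: "S \<subseteq> {..<n}" "\<And>j. j \<in> S \<Longrightarrow> (j + 1) mod n \<notin> S" "card S = q" "n - 1 \<in> S"
      by (auto simp: cyclic_sparse_sets_def)
    have fin: "finite S" using SB cyclic_sparse_sets_finite by auto
    have q: "q \<noteq> 0" using S(3,4) fin by (metis card_0_eq empty_iff)
    have suc: "Suc j \<notin> S" if "j \<in> S" for j
      using S(1) S(2)[OF that] mod[of j] that by (cases "j = n - 1") auto
    have zero: "0 \<notin> S" using S(2)[OF S(4)] mod[of "n - 1"] n by simp
    have "S - {n - 1} \<subseteq> {1..<1 + (n - 3)}"
    proof
      fix x assume x: "x \<in> S - {n - 1}"
      have "x \<noteq> 0" using x zero by (metis DiffD1)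
      moreover have "x < n - 1" using x S(1) by force
      moreover have "Suc x \<noteq> n - 1" using suc[of x] x S(4) by auto
      ultimately show "x \<in> {1..<1 + (n - 3)}" by simp
    qed
    then have "S - {n - 1} \<in> sparse_sets 1 (n - 3) (q - 1)"
      using S fin suc by (auto simp: sparse_sets_def)
    moreover have "S = insert (n - 1) (S - {n - 1})" using S by auto
    ultimately show "S \<in> (if q = 0 then {} else insert (n - 1) ` sparse_sets 1 (n - 3) (q - 1))"
      using q by (metis (no_types, lifting) image_eqI)
  next
    fix S assume "S \<in> (if q = 0 then {} else insert (n - 1) ` sparse_sets 1 (n - 3) (q - 1))"
    then obtain S' where S': "q \<noteq> 0" "S' \<in> sparse_sets 1 (n - 3) (q - 1)" "S = insert (n - 1) S'"
      by (auto split: if_splits)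
    have fin: "finite S'" by (rule sparse_sets_finite[OF S'(2)])
    have S'': "S' \<subseteq> {1..<1 + (n - 3)}" "\<And>j. j \<in> S' \<Longrightarrow> Suc j \<notin> S'" "card S' = q - 1"
      using S'(2) by (auto simp: sparse_sets_def)
    have rng: "0 < j \<and> j < n - 2" if "j \<in> S'" for j using S''(1) that by force
    have nn: "n - 1 \<notin> S'" "0 \<notin> S'" using rng by force+
    have "(j + 1) mod n \<notin> S" if "j \<in> S" for j
    proof (cases "j = n - 1")
      case True
      then show ?thesis using nn S'(3) mod[of j] n by simp
    next
      case False
      then have "j \<in> S'" using that S'(3) by auto
      then show ?thesis using rng[of j] S''(2)[of j] mod[of j] S'(3) by auto
    qed
    moreover have "S \<subseteq> {..<n}" using rng S'(3) n by force
    moreover have "card S = q" using S' S'' nn fin by auto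
    ultimately show "S \<in> ?B" using S'(3) by (auto simp: cyclic_sparse_sets_def)
  qed
  have "?C = ?A \<union> ?B" by auto
  then have "card ?C = card (?A \<union> ?B)" by metis
  also have "\<dots> = card ?A + card ?B"
    by (rule card_Un_disjoint) (auto intro: finite_subset[OF _ finite_cyclic_sparse_sets[of n]])
  also have "card ?A = (n - q) choose q"
    unfolding A card_sparse_sets using n by simp
  also have "card ?B = (if q = 0 then 0 else (n - q - 1) choose (q - 1))"
  proof (cases "q = 0")
    case False
    have notin: "n - 1 \<notin> S" if "S \<in> sparse_sets 1 (n - 3) (q - 1)" for S
      using that n by (force simp: sparse_sets_def)
    have "inj_on (insert (n - 1)) (sparse_sets 1 (n - 3) (q - 1))"
      by (rule inj_onI) (metis notin insert_ident)
    then have "card ?B = (n - 3 + 1 - (q - 1)) choose (q - 1)"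
      using False by (simp only: B if_False card_image card_sparse_sets)
    also have "\<dots> = (n - q - 1) choose (q - 1)"
    \<comment> \<open>Here \<open>n - 3\<close> truncates and the upper entries can differ, but both
      binomials are 1 for \<open>q = 1\<close> and 0 for larger \<open>q\<close>.\<close>
    proof (cases "n = 2")
      case True
      then show ?thesis using False by (cases "q = 1") auto
    next
      case n2: False
      have "n - 3 + 1 - (q - 1) = n - q - 1" using False n n2 by simp
      then show ?thesis by simp
    qed
    finally show ?thesis using False by simp
  next
    case True
    then show ?thesis unfolding B by simp
  qed
  finally show ?thesis by (simp add: cyclic_sparse_count_def)
qed

section \<open>Factorial form of the counts\<close>

lemma cyclic_sparse_count_choose:
  assumes "n \<ge> 2" "p \<le> n" "q \<le> p"
  shows "of_nat (cyclic_sparse_count n q * ((n - 2 * q) choose (p - q))) = bnum_term n p q"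
proof (cases "q > n - p")
  case True
  \<comment> \<open>So large a \<open>q\<close> kills the second factor if
    \<open>2 * q \<le> n\<close>, and both binomials of the first factor otherwise.\<close>
  have "cyclic_sparse_count n q * ((n - 2 * q) choose (p - q)) = 0"
  proof (cases "2 * q \<le> n")
    case le: True
    have "n - 2 * q < p - q" using True le assms by linarith
    then show ?thesis by simp
  next
    case False
    then have "n - q < q" "n - q - 1 < q - 1" using assms by linarith+
    then show ?thesis by (simp add: cyclic_sparse_count_def)
  qed
  then show ?thesis using True by (simp only: bnum_term_def) simp
next
  case False
  then have le: "q + p \<le> n" "2 * q \<le> n" using assms by auto
  define d where "d = n - 2 * q"
  have n: "n = d + 2 * q" using le by (simp add: d_def)
  have cnt: "of_nat (cyclic_sparse_count n q) * fact q * fact d = (of_nat n * fact (n - q - 1) :: rat)"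
  proof (cases q)
    case 0
    then show ?thesis using assms n
      by (cases n) (auto simp: cyclic_sparse_count_def)
  next
    case (Suc k)
    have e: "n - q = Suc (d + k)" "n - q - 1 = d + k" "q - 1 = k" "n = d + 2 * Suc k" using n Suc by auto
    have c1: "of_nat (Suc (d + k) choose Suc k) * fact (Suc k) * fact d = (fact (Suc (d + k)) :: rat)"
      using arg_cong[OF binomial_fact_lemma[of "Suc k" "Suc (d + k)"], of rat_of_nat]
      by (simp add: ac_simps del: binomial_Suc_Suc fact_Suc)
    have c2: "of_nat ((d + k) choose k) * fact k * fact d = (fact (d + k) :: rat)"
      by (subst binomial_fact) (auto simp: field_simps)
    \<comment> \<open>With \<open>q = k + 1\<close> the two summands become
      \<open>(d + k + 1)!\<close> and \<open>(k + 1) * (d + k)!\<close>; they add up to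
      \<open>n * (d + k)!\<close> because \<open>n = d + 2 * (k + 1)\<close>.\<close>
    have "of_nat (cyclic_sparse_count n q) * fact q * fact d =
      of_nat (Suc (d + k) choose Suc k) * fact (Suc k) * fact d +
      (of_nat (Suc k) * (of_nat ((d + k) choose k) * fact k * fact d) :: rat)"
      unfolding cyclic_sparse_count_def e using Suc by (simp add: algebra_simps del: binomial_Suc_Suc)
    also have "\<dots> = (of_nat n * fact (n - q - 1) :: rat)"
      unfolding c1 c2 e(2) by (simp add: e(4) algebra_simps)
    finally show ?thesis .
  qed
  have pq: "of_nat (d choose (p - q)) = (fact d / (fact (p - q) * fact (n - q - p)) :: rat)"
    using le assms by (subst binomial_fact) (auto simp: d_def algebra_simps)
  have "of_nat (cyclic_sparse_count n q * (d choose (p - q))) =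
     (of_nat (cyclic_sparse_count n q) * fact q * fact d) / (fact q * fact (p - q) * fact (n - q - p) :: rat)"
    by (simp add: pq)
  then show ?thesis using False unfolding cnt by (simp add: bnum_term_def d_def)
qed

section \<open>Matchings of w-weight 0\<close>

definition prev :: "nat \<Rightarrow> nat \<Rightarrow> nat" where
  "prev n j = (if j = 0 then n - 1 else j - 1)"

lemma prev_less: "j < n \<Longrightarrow> prev n j < n"
  by (auto simp: prev_def)

lemma prev_neq: "n \<ge> 2 \<Longrightarrow> j < n \<Longrightarrow> prev n j \<noteq> j"
  by (auto simp: prev_def)

text \<open>\<open>Hor r i\<close> ends in column \<open>Suc i mod n\<close>, so the horizontal edge
  reaching column \<open>j\<close> from the left is \<open>Hor r (prev n j)\<close>.\<close>

lemma Suc_mod_eq_iff: "i < n \<Longrightarrow> j < n \<Longrightarrow> Suc i mod n = j \<longleftrightarrow> i = prev n j"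
  by (cases "Suc i = n") (auto simp: prev_def)

lemma inj_on_prev: "inj_on (prev n) {..<n}"
  by (auto simp: inj_on_def prev_def split: if_splits)

text \<open>The wrap-around from column 0 to \<open>n - 1\<close> changes parity too, because
  \<open>n\<close> is even.\<close>

lemma even_prev: "even n \<Longrightarrow> j < n \<Longrightarrow> even (prev n j) \<longleftrightarrow> odd j"
  by (auto simp: prev_def)

text \<open>Looking back to the left neighbour fits the matching condition at a node of column
  \<open>j\<close>, which forbids using both of its horizontal edges.\<close>

lemma cyclic_sparse_sets_prev:
  "S \<in> cyclic_sparse_sets n \<longleftrightarrow> S \<subseteq> {..<n} \<and> (\<forall>j<n. \<not> (j \<in> S \<and> prev n j \<in> S))" (is "?L \<longleftrightarrow> ?R")
proof
  assume L: ?L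
  then have sub: "S \<subseteq> {..<n}" by (simp add: cyclic_sparse_sets_def)
  have "\<not> (j \<in> S \<and> prev n j \<in> S)" if "j < n" for j
    using L that Suc_mod_eq_iff[of "prev n j" n j] prev_less[of j n]
    by (auto simp: cyclic_sparse_sets_def)
  then show ?R using sub by blast
next
  assume R: ?R
  have "Suc j mod n \<notin> S" if "j \<in> S" for j
  proof -
    have j: "j < n" using R that by auto
    then have "Suc j mod n < n" by auto
    moreover have "prev n (Suc j mod n) = j" using Suc_mod_eq_iff[OF j calculation] by simp
    ultimately show ?thesis using R that by metis
  qed
  then show ?L using R by (simp add: cyclic_sparse_sets_def)
qed

section \<open>The matching condition at a single node\<close>

lemma ex1_four:
  assumes "distinct [a, b, c, d]"
  shows "(\<exists>!e. e \<in> M \<and> e \<in> {a, b, c, d}) \<longleftrightarrow>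
    (a \<in> M \<and> b \<notin> M \<and> c \<notin> M \<and> d \<notin> M) \<or> (a \<notin> M \<and> b \<in> M \<and> c \<notin> M \<and> d \<notin> M) \<or>
    (a \<notin> M \<and> b \<notin> M \<and> c \<in> M \<and> d \<notin> M) \<or> (a \<notin> M \<and> b \<notin> M \<and> c \<notin> M \<and> d \<in> M)"
  using assms by (cases "a \<in> M"; cases "b \<in> M"; cases "c \<in> M"; cases "d \<in> M") auto

lemma incident_edge_iff:
  assumes "n \<ge> 2" "r < 2" "j < n" "e \<in> edges n"
  shows "(r, j) \<in> endpoints n e \<longleftrightarrow> e \<in> {Hor r j, Hor r (prev n j), Ver 0 j, Ver 1 j}"
proof (cases e)
  case (Hor s i)
  then have "i < n" using assms by (auto simp: edges_def)
  then show ?thesis using Hor assms Suc_mod_eq_iff[of i n j] by auto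
next
  case (Ver s i)
  then have "s < 2" using assms by (auto simp: edges_def)
  then have "s = 0 \<or> s = 1" "r = 0 \<or> r = 1" using assms by auto
  then show ?thesis using Ver by auto
qed

text \<open>An explicit disjunction leaves only propositional reasoning. Its vertical edges do not
  depend on the row, since both of them join the two nodes of the column.\<close>

definition covered_once :: "nat \<Rightarrow> edge set \<Rightarrow> nat \<Rightarrow> nat \<Rightarrow> bool" where
  "covered_once n M r j \<longleftrightarrow>
    (Hor r j \<in> M \<and> Hor r (prev n j) \<notin> M \<and> Ver 0 j \<notin> M \<and> Ver 1 j \<notin> M) \<or>
    (Hor r j \<notin> M \<and> Hor r (prev n j) \<in> M \<and> Ver 0 j \<notin> M \<and> Ver 1 j \<notin> M) \<or>
    (Hor r j \<notin> M \<and> Hor r (prev n j) \<notin> M \<and> Ver 0 j \<in> M \<and> Ver 1 j \<notin> M) \<or>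
    (Hor r j \<notin> M \<and> Hor r (prev n j) \<notin> M \<and> Ver 0 j \<notin> M \<and> Ver 1 j \<in> M)"

lemma perfect_matching_iff:
  assumes n: "n \<ge> 2"
  shows "perfect_matching n M \<longleftrightarrow> M \<subseteq> edges n \<and> (\<forall>r<2. \<forall>j<n. covered_once n M r j)"
proof (cases "M \<subseteq> edges n")
  case True
  have "(\<exists>!e. e \<in> M \<and> (r, j) \<in> endpoints n e) \<longleftrightarrow> covered_once n M r j" if rj: "r < 2" "j < n" for r j
  proof -
    have "(e \<in> M \<and> (r, j) \<in> endpoints n e) \<longleftrightarrow>
        (e \<in> M \<and> e \<in> {Hor r j, Hor r (prev n j), Ver 0 j, Ver 1 j})" for e
      using incident_edge_iff[OF n rj, of e] True by blast
    then have "(\<exists>!e. e \<in> M \<and> (r, j) \<in> endpoints n e) \<longleftrightarrow>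
        (\<exists>!e. e \<in> M \<and> e \<in> {Hor r j, Hor r (prev n j), Ver 0 j, Ver 1 j})" by presburger
    also have "\<dots> \<longleftrightarrow> covered_once n M r j"
      unfolding covered_once_def
      \<comment> \<open>The four labels are distinct since \<open>prev n j\<close> differs from
        \<open>j\<close>; this holds even for \<open>n = 2\<close>, where the two horizontal edges
        are parallel.\<close>
      by (rule ex1_four) (use prev_neq[OF n rj(2)] in auto)
    finally show ?thesis .
  qed
  then show ?thesis using True by (auto simp: perfect_matching_def nodes_def)
qed (simp add: perfect_matching_def)

lemma finite_edges: "finite (edges n)"
proof -
  have "edges n = (\<lambda>(r, j). Hor r j) ` ({..<2} \<times> {..<n}) \<union> (\<lambda>(r, j). Ver r j) ` ({..<2} \<times> {..<n})"
    by (auto simp: edges_def)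
  then show ?thesis by simp
qed

lemma finite_perfect_matchings: "finite {M. perfect_matching n M}"
  by (rule finite_subset[of _ "Pow (edges n)"]) (auto simp: perfect_matching_def finite_edges)

text \<open>As \<open>n - 1\<close> is odd, the top node of the last column is black and the bottom
  one white, so the two edges across the cut count with opposite signs.\<close>

lemma w_weight_eq:
  assumes "n \<ge> 2" "even n" "M \<subseteq> edges n"
  shows "(\<Sum>e\<in>M. w_crossing n e) = of_bool (Hor 1 (n - 1) \<in> M) - of_bool (Hor 0 (n - 1) \<in> M)"
proof -
  have fin: "finite M" by (rule finite_subset[OF assms(3) finite_edges])
  have "(\<Sum>e\<in>M. w_crossing n e) = (\<Sum>e\<in>M \<inter> {Hor 0 (n - 1), Hor 1 (n - 1)}. w_crossing n e)"
  proof (rule sum.mono_neutral_right[OF fin])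
    show "\<forall>e\<in>M - M \<inter> {Hor 0 (n - 1), Hor 1 (n - 1)}. w_crossing n e = 0"
    proof
      fix e assume e: "e \<in> M - M \<inter> {Hor 0 (n - 1), Hor 1 (n - 1)}"
      show "w_crossing n e = 0"
      proof (cases e)
        case (Hor r j)
        then have "r = 0 \<or> r = 1" using e assms(3) by (auto simp: edges_def)
        then show ?thesis using Hor e by auto
      qed simp
    qed
  qed auto
  also have "\<dots> = of_bool (Hor 1 (n - 1) \<in> M) - of_bool (Hor 0 (n - 1) \<in> M)"
    using assms by (auto simp: Int_insert_right black_def)
  finally show ?thesis .
qed

text \<open>
  Both nodes of a column see the same vertical edges, so the difference of the two rows of
  horizontal edges changes sign from one column to the next; w-weight 0 makes it vanish
  at the cut.
\<close>
lemma rows_agree: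
  assumes n: "n \<ge> 2" "even n" and pm: "perfect_matching n M" and w: "snd (weight n M) = 0"
    and j: "j < n"
  shows "Hor 1 j \<in> M \<longleftrightarrow> Hor 0 j \<in> M"
proof -
  have sub: "M \<subseteq> edges n" using pm by (simp add: perfect_matching_def)
  have last: "Hor 1 (n - 1) \<in> M \<longleftrightarrow> Hor 0 (n - 1) \<in> M"
    using w w_weight_eq[OF n sub] by (auto simp: weight_def split: if_splits)
  have step: "(Hor 1 i \<in> M \<longleftrightarrow> Hor 0 i \<in> M)"
    if "i < n" "Hor 1 (prev n i) \<in> M \<longleftrightarrow> Hor 0 (prev n i) \<in> M" for i
  proof -
    have "covered_once n M 0 i" "covered_once n M 1 i"
      using pm that(1) by (auto simp: perfect_matching_iff[OF n(1)])
    then show ?thesis using that(2) unfolding covered_once_def by argo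
  qed
  show ?thesis using j
  proof (induction j)
    case 0
    then show ?case using step[of 0] last by (simp add: prev_def)
  next
    case (Suc j)
    then show ?case using step[of "Suc j"] by (simp add: prev_def)
  qed
qed

section \<open>Encoding of matchings by pairs of column sets\<close>

definition free_columns :: "nat \<Rightarrow> nat set \<Rightarrow> nat set" where
  "free_columns n S = {j. j < n \<and> j \<notin> S \<and> prev n j \<notin> S}"

text \<open>
  The matching that has both horizontal edges to the right of each column in \<open>S\<close> and a vertical
  edge in every other column.  The set \<open>T\<close> consists of the columns where the vertical edge
  has the smaller of its two possible z-crossings.
\<close>
definition strip_matching :: "nat \<Rightarrow> nat set \<times> nat set \<Rightarrow> edge set" where
  "strip_matching n = (\<lambda>(S, T). {Hor r j | r j. r < 2 \<and> j \<in> S} \<union>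
     (\<lambda>j. Ver (if odd j \<longleftrightarrow> j \<in> T then 0 else 1) j) ` free_columns n S)"

definition strip_codes :: "nat \<Rightarrow> (nat set \<times> nat set) set" where
  "strip_codes n = (SIGMA S:cyclic_sparse_sets n. Pow (free_columns n S))"

lemma Hor_in_strip_matching: "Hor r j \<in> strip_matching n (S, T) \<longleftrightarrow> r < 2 \<and> j \<in> S"
  by (auto simp: strip_matching_def)

lemma Ver_in_strip_matching:
  "Ver r j \<in> strip_matching n (S, T) \<longleftrightarrow>
     j \<in> free_columns n S \<and> r = (if odd j \<longleftrightarrow> j \<in> T then 0 else 1)"
  by (auto simp: strip_matching_def)

text \<open>The horizontal edges of row 0 recover \<open>S\<close>. The edges \<open>Ver 0 j\<close>
  in free columns recover \<open>T\<close>, which has no elements elsewhere.\<close>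

lemma inj_on_strip_matching: "inj_on (strip_matching n) (strip_codes n)"
proof (rule inj_onI, clarify)
  fix S T S' T'
  assume codes: "(S, T) \<in> strip_codes n" "(S', T') \<in> strip_codes n"
    and eq: "strip_matching n (S, T) = strip_matching n (S', T')"
  have S: "S = S'"
  proof (rule set_eqI)
    fix j
    show "j \<in> S \<longleftrightarrow> j \<in> S'"
      using Hor_in_strip_matching[of 0 j n S T] Hor_in_strip_matching[of 0 j n S' T'] eq by simp
  qed
  have sub: "T \<subseteq> free_columns n S" "T' \<subseteq> free_columns n S"
    using codes S by (auto simp: strip_codes_def)
  have "T = T'"
  proof (rule set_eqI)
    fix j
    show "j \<in> T \<longleftrightarrow> j \<in> T'"
    proof (cases "j \<in> free_columns n S")
      case True
      then show ?thesis
        using Ver_in_strip_matching[of 0 j n S T] Ver_in_strip_matching[of 0 j n S' T'] eq S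
        by (auto split: if_splits)
    qed (use sub in auto)
  qed
  then show "S = S' \<and> T = T'" using S by simp
qed

text \<open>Each column \<open>j\<close> satisfies exactly one of \<open>j \<in> S\<close>,
  \<open>prev n j \<in> S\<close> and being free, since sparsity excludes the overlap of the first
  two.\<close>

lemma perfect_matching_strip_matching:
  assumes n: "n \<ge> 2" and code: "(S, T) \<in> strip_codes n"
  shows "perfect_matching n (strip_matching n (S, T))"
proof -
  have S: "S \<subseteq> {..<n}" "\<And>j. j < n \<Longrightarrow> \<not> (j \<in> S \<and> prev n j \<in> S)"
    using code by (auto simp: strip_codes_def cyclic_sparse_sets_prev)
  have "strip_matching n (S, T) \<subseteq> edges n"
    using S(1) by (auto simp: strip_matching_def edges_def free_columns_def split: if_splits)
  moreover have "covered_once n (strip_matching n (S, T)) r j" if "r < 2" "j < n" for r j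
    using S(2)[OF that(2)] that
    by (auto simp: covered_once_def Hor_in_strip_matching Ver_in_strip_matching free_columns_def)
  ultimately show ?thesis by (simp add: perfect_matching_iff[OF n])
qed

text \<open>The bottom row determines \<open>S\<close>, and \<open>rows_agree\<close> carries it to
  the top row. Covering \<open>(0, j)\<close> once then leaves one vertical edge in each free column
  and none elsewhere.\<close>

lemma strip_matching_surj:
  assumes n: "n \<ge> 2" "even n" and pm: "perfect_matching n M" and w: "snd (weight n M) = 0"
  shows "M \<in> strip_matching n ` strip_codes n"
proof -
  define S where "S = {j. j < n \<and> Hor 0 j \<in> M}"
  \<comment> \<open>The edge named here has z-crossing 0 in an odd column, against 1 for its
    parallel edge, and -1 in an even one, against 0.\<close>
  define T where "T = {j \<in> free_columns n S. Ver (if odd j then 0 else 1) j \<in> M}"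
  have sub: "M \<subseteq> edges n" using pm by (simp add: perfect_matching_def)
  have cov: "covered_once n M r j" if "r < 2" "j < n" for r j
    using pm that by (simp add: perfect_matching_iff[OF n(1)])
  have "\<not> (j \<in> S \<and> prev n j \<in> S)" if "j < n" for j
    using cov[of 0 j] that unfolding covered_once_def S_def by auto
  then have code: "(S, T) \<in> strip_codes n"
    by (auto simp: strip_codes_def cyclic_sparse_sets_prev S_def T_def)
  have "M = strip_matching n (S, T)"
  proof (rule set_eqI)
    fix e
    show "e \<in> M \<longleftrightarrow> e \<in> strip_matching n (S, T)"
    proof (cases e)
      case (Hor r j)
      show ?thesis
      proof (cases "r < 2 \<and> j < n")
        case True
        then have "r = 0 \<or> r = 1" by auto
        then show ?thesis using True rows_agree[OF n pm w, of j] Hor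
          by (auto simp: Hor_in_strip_matching S_def)
      next
        case False
        then show ?thesis using sub Hor by (auto simp: Hor_in_strip_matching S_def edges_def)
      qed
    next
      case (Ver r j)
      show ?thesis
      proof (cases "r < 2 \<and> j < n")
        case True
        then have "r = 0 \<or> r = 1" by auto
        then show ?thesis using True cov[of 0 j] Ver prev_less[of j n]
          by (auto simp: Ver_in_strip_matching T_def S_def free_columns_def covered_once_def)
      next
        case False
        then show ?thesis using sub Ver
          by (auto simp: Ver_in_strip_matching free_columns_def edges_def)
      qed
    qed
  qed
  then show ?thesis using code by blast
qed

text \<open>The right neighbours \<open>P\<close> of \<open>S\<close> are disjoint from
  \<open>S\<close> by sparsity, and \<open>prev n\<close> maps \<open>P\<close> bijectively onto
  \<open>S\<close>. For even \<open>n\<close> this map reverses parity, so \<open>S\<close> and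
  \<open>P\<close> together contain \<open>card S\<close> of the \<open>n div 2\<close> odd
  columns.\<close>

lemma card_free_columns:
  assumes n: "n \<ge> 2" and S: "S \<in> cyclic_sparse_sets n"
  shows "card (free_columns n S) = n - 2 * card S" "2 * card S \<le> n"
    and "even n \<Longrightarrow> int (card {j \<in> free_columns n S. odd j}) = int (n div 2) - int (card S)"
proof -
  have Sn: "S \<subseteq> {..<n}" and indep: "\<And>j. j < n \<Longrightarrow> \<not> (j \<in> S \<and> prev n j \<in> S)"
    using S by (auto simp: cyclic_sparse_sets_prev)
  define P where "P = {j. j < n \<and> prev n j \<in> S}"
  have fin: "finite S" "finite P" using cyclic_sparse_sets_finite[OF S] by (auto simp: P_def)
  have "prev n ` {..<n} \<subseteq> {..<n}" using prev_less by blast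
  then have surj: "prev n ` {..<n} = {..<n}" by (intro endo_inj_surj inj_on_prev finite_lessThan)
  have injP: "inj_on (prev n) P" by (rule inj_on_subset[OF inj_on_prev]) (auto simp: P_def)
  have PS: "prev n ` P = S" using surj Sn by (auto simp: P_def)
  have disj: "S \<inter> P = {}" using indep by (auto simp: P_def)
  have cardP: "card P = card S" using card_image[OF injP] PS by simp
  have free: "free_columns n S = {..<n} - (S \<union> P)" by (auto simp: free_columns_def P_def)
  have cardSP: "card (S \<union> P) = 2 * card S" using card_Un_disjoint[OF fin disj] cardP by simp
  have sub: "S \<union> P \<subseteq> {..<n}" using Sn by (auto simp: P_def)
  show "card (free_columns n S) = n - 2 * card S"
    using card_Diff_subset[OF _ sub] fin cardSP free by simp
  show "2 * card S \<le> n" using card_mono[OF finite_lessThan sub] cardSP by simp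
  assume ev: "even n"
  have "prev n ` {j \<in> P. odd j} = {j \<in> S. even j}"
  proof -
    have "even (prev n j) \<longleftrightarrow> odd j" if "j \<in> P" for j
      using that ev even_prev by (auto simp: P_def)
    then show ?thesis unfolding PS[symmetric] by auto
  qed
  then have 1: "card {j \<in> P. odd j} = card {j \<in> S. even j}"
    using card_image[OF inj_on_subset[OF injP, of "{j \<in> P. odd j}"]] by auto
  have "card S = card ({j \<in> S. odd j} \<union> {j \<in> S. even j})" by (rule arg_cong[where f = card]) auto
  also have "\<dots> = card {j \<in> S. odd j} + card {j \<in> S. even j}"
    by (rule card_Un_disjoint) (use fin in auto)
  finally have 2: "card S = card {j \<in> S. odd j} + card {j \<in> S. even j}" .
  have "card {j. j < n \<and> odd j} = n div 2"
  proof -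
    have "{j. j < n \<and> odd j} = (\<lambda>i. 2 * i + 1) ` {..<n div 2}"
      using ev by (auto elim!: oddE)
    then show ?thesis by (simp add: card_image inj_on_def)
  qed
  moreover have "{j. j < n \<and> odd j} = {j \<in> free_columns n S. odd j} \<union> ({j \<in> S. odd j} \<union> {j \<in> P. odd j})"
    using free sub by auto
  moreover have "card \<dots> = card {j \<in> free_columns n S. odd j} + card ({j \<in> S. odd j} \<union> {j \<in> P. odd j})"
    by (rule card_Un_disjoint) (use fin free in auto)
  moreover have "card ({j \<in> S. odd j} \<union> {j \<in> P. odd j}) = card {j \<in> S. odd j} + card {j \<in> P. odd j}"
    by (rule card_Un_disjoint) (use fin disj in auto)
  ultimately show "int (card {j \<in> free_columns n S. odd j}) = int (n div 2) - int (card S)"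
    using 1 2 by simp
qed

section \<open>Weights and number of the encoded matchings\<close>

lemma finite_free_columns: "finite (free_columns n S)"
  by (simp add: free_columns_def)

lemma weight_strip_matching:
  assumes n: "n \<ge> 2" "even n" and code: "(S, T) \<in> strip_codes n"
  shows "weight n (strip_matching n (S, T)) = (int (n div 2) - int (card S + card T), 0)"
proof -
  let ?R = "free_columns n S" and ?v = "\<lambda>j. Ver (if odd j \<longleftrightarrow> j \<in> T then 0 else 1) j"
  let ?M = "strip_matching n (S, T)"
  have S: "S \<in> cyclic_sparse_sets n" and T: "T \<subseteq> ?R" using code by (auto simp: strip_codes_def)
  have sub: "?M \<subseteq> edges n"
    using perfect_matching_strip_matching[OF n(1) code] by (simp add: perfect_matching_def)
  have finM: "finite ?M" by (rule finite_subset[OF sub finite_edges])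
  have "(\<Sum>e\<in>?M. z_crossing e) = (\<Sum>e\<in>?v ` ?R. z_crossing e)"
    by (rule sum.mono_neutral_right[OF finM]) (auto simp: strip_matching_def)
  also have "\<dots> = (\<Sum>j\<in>?R. z_crossing (?v j))"
    by (subst sum.reindex) (auto simp: inj_on_def)
  \<comment> \<open>In either parity, membership in \<open>T\<close> lowers the crossing by 1: from
    1 in odd columns, from 0 in even ones.\<close>
  also have "\<dots> = (\<Sum>j\<in>?R. of_bool (odd j) - of_bool (j \<in> T))"
    by (rule sum.cong) (auto simp: black_def)
  also have "\<dots> = int (card {j \<in> ?R. odd j}) - int (card {j \<in> ?R. j \<in> T})"
    by (simp add: sum_subtractf sum_of_bool_eq finite_free_columns Int_def)
  also have "{j \<in> ?R. j \<in> T} = T" using T by auto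
  finally have "(\<Sum>e\<in>?M. z_crossing e) = int (n div 2) - int (card S + card T)"
    using card_free_columns(3)[OF n(1) S n(2)] by simp
  moreover have "(\<Sum>e\<in>?M. w_crossing n e) = 0"
    by (simp add: w_weight_eq[OF n sub] Hor_in_strip_matching)
  ultimately show ?thesis by (simp add: weight_def)
qed

lemma w_weight_0_matchings:
  assumes n: "n \<ge> 2" "even n"
  shows "{M. perfect_matching n M \<and> snd (weight n M) = 0} = strip_matching n ` strip_codes n"
  using strip_matching_surj[OF n] perfect_matching_strip_matching[OF n(1)] weight_strip_matching[OF n]
  by fastforce

lemma strip_codes_card_le:
  assumes n: "n \<ge> 2" and code: "(S, T) \<in> strip_codes n"
  shows "card S + card T \<le> n"
proof -
  have S: "S \<in> cyclic_sparse_sets n" and T: "T \<subseteq> free_columns n S"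
    using code by (auto simp: strip_codes_def)
  show ?thesis
    using card_mono[OF finite_free_columns T] card_free_columns(1,2)[OF n S] by linarith
qed

text \<open>This allows the sum over occurring weights to be indexed by \<open>p\<close> from 0 to
  \<open>n\<close>, where \<open>p\<close> is \<open>card S + card T\<close>.\<close>

lemma z_weight_range:
  assumes n: "n \<ge> 2" "even n" and M: "perfect_matching n M" "weight n M = (k, 0)"
  shows "k \<in> (\<lambda>p. int (n div 2) - int p) ` {0..n}"
proof -
  obtain S T where "(S, T) \<in> strip_codes n" "M = strip_matching n (S, T)"
    using strip_matching_surj[OF n M(1)] M(2) by auto
  then show ?thesis
    using weight_strip_matching[OF n, of S T] strip_codes_card_le[OF n(1), of S T] M(2)
    by (intro image_eqI[of _ _ "card S + card T"]) auto
qed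

text \<open>The codes of total size \<open>p\<close> are sorted by \<open>q = card S\<close>; then
  \<open>T\<close> is any subset of size \<open>p - q\<close> of the \<open>n - 2 * q\<close> free
  columns.\<close>

lemma bnum_eq_sum:
  assumes n: "n \<ge> 2" "even n"
  shows "bnum n p = (\<Sum>q=0..p. cyclic_sparse_count n q * ((n - 2 * q) choose (p - q)))"
proof -
  let ?codes = "{c \<in> strip_codes n. card (fst c) + card (snd c) = p}"
  let ?C = "\<lambda>q. {S \<in> cyclic_sparse_sets n. card S = q}"
  let ?T = "\<lambda>q S. {T. T \<subseteq> free_columns n S \<and> card T = p - q}"
  have "bnum n p = card {M. perfect_matching n M \<and> weight n M = (int (n div 2) - int p, 0)}"
    by (simp add: bnum_def num_matchings_def)
  also have "{M. perfect_matching n M \<and> weight n M = (int (n div 2) - int p, 0)} = strip_matching n ` ?codes"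
  proof -
    have "{M. perfect_matching n M \<and> weight n M = (int (n div 2) - int p, 0)} =
        {M \<in> strip_matching n ` strip_codes n. weight n M = (int (n div 2) - int p, 0)}"
      unfolding w_weight_0_matchings[OF n, symmetric] by auto
    also have "\<dots> = strip_matching n ` ?codes"
      using weight_strip_matching[OF n] by fastforce
    finally show ?thesis .
  qed
  also have "card \<dots> = card ?codes"
    by (rule card_image[OF inj_on_subset[OF inj_on_strip_matching]]) auto
  also have "?codes = (\<Union>q\<in>{0..p}. SIGMA S:?C q. ?T q S)"
    by (auto simp: strip_codes_def)
  also have "card \<dots> = (\<Sum>q=0..p. card (SIGMA S:?C q. ?T q S))"
    by (rule card_UN_disjoint)
      (auto simp: finite_cyclic_sparse_sets finite_free_columns intro!: finite_SigmaI)
  also have "\<dots> = (\<Sum>q=0..p. cyclic_sparse_count n q * ((n - 2 * q) choose (p - q)))"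
  proof (rule sum.cong[OF refl])
    fix q
    have "card (SIGMA S:?C q. ?T q S) = (\<Sum>S\<in>?C q. card (?T q S))"
      by (rule card_SigmaI) (auto simp: finite_cyclic_sparse_sets finite_free_columns)
    also have "\<dots> = (\<Sum>S\<in>?C q. (n - 2 * q) choose (p - q))"
      by (rule sum.cong)
        (auto simp: n_subsets[OF finite_free_columns] card_free_columns(1)[OF n(1)])
    also have "\<dots> = cyclic_sparse_count n q * ((n - 2 * q) choose (p - q))"
      by (simp add: card_cyclic_sparse_sets[OF n(1)])
    finally show "card (SIGMA S:?C q. ?T q S) = \<dots>" .
  qed
  finally show ?thesis .
qed

lemma of_nat_bnum:
  assumes "n \<ge> 2" "even n" "p \<le> n"
  shows "of_nat (bnum n p) = (\<Sum>q=0..p. bnum_term n p q)"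
  unfolding bnum_eq_sum[OF assms(1,2)] of_nat_sum
  by (rule sum.cong) (auto simp only: cyclic_sparse_count_choose[OF assms(1,3)] atLeastAtMost_iff)

lemma bnum_symmetric:
  assumes n: "n \<ge> 2" "even n" and p: "p \<le> n"
  shows "bnum n (n - p) = bnum n p"
proof -
  \<comment> \<open>Cutting the range at \<open>min p (n - p)\<close> makes it invariant under
    exchanging \<open>p\<close> and \<open>n - p\<close>.\<close>
  have trim: "bnum n p = (\<Sum>q=0..min p (n - p). cyclic_sparse_count n q * ((n - 2 * q) choose (p - q)))"
    if "p \<le> n" for p
    unfolding bnum_eq_sum[OF n]
  proof (rule sum.mono_neutral_right)
    show "\<forall>q\<in>{0..p} - {0..min p (n - p)}. cyclic_sparse_count n q * (n - 2 * q choose (p - q)) = 0"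
    proof
      fix q assume "q \<in> {0..p} - {0..min p (n - p)}"
      then have q: "q \<le> p" "q > n - p" by auto
      \<comment> \<open>The detour through the rationals uses that the zero branch of
        \<open>bnum_term\<close> covers the discarded \<open>q\<close>.\<close>
      then have "rat_of_nat (cyclic_sparse_count n q * (n - 2 * q choose (p - q))) = 0"
        unfolding cyclic_sparse_count_choose[OF n(1) that q(1)] by (simp add: bnum_term_def)
      then show "cyclic_sparse_count n q * (n - 2 * q choose (p - q)) = 0"
        by (simp only: of_nat_eq_0_iff)
    qed
  qed auto
  have "(n - 2 * q) choose (n - p - q) = (n - 2 * q) choose (p - q)" if "q \<le> min p (n - p)" for q
  proof -
    have "n - p - q \<le> n - 2 * q" "n - 2 * q - (n - p - q) = p - q" using that p by auto
    then show ?thesis using binomial_symmetric by metis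
  qed
  then show ?thesis
    unfolding trim[OF p] trim[OF diff_le_self] using p
    by (intro sum.cong) (auto simp: min.commute)
qed

section \<open>The Newton polynomial\<close>

text \<open>All factors but the last are constants as series in w, so only exponent 0 of w
  contributes.\<close>

lemma newton_term_nth_0:
  "fls_nth (of_nat N * (-1) powi s * fls_const fls_X powi a * fls_X powi b :: rat fls fls) 0 =
     (if b = 0 then of_nat N * (-1) powi s * fls_X powi a else 0)"
proof -
  have "of_nat N * (-1) powi s * fls_const fls_X powi a =
      fls_const (of_nat N * (-1) powi s * fls_X powi a :: rat fls)"
    by (simp add: fls_of_nat fls_const_power_int del: fls_X_power_int flip: fls_const_mult_const)
  moreover have "(fls_X powi b :: rat fls fls) = fls_X_intpow b"
    by (rule fls_X_power_int)
  ultimately show ?thesis by simp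
qed

lemma newton_polynomial_z_eq_sum:
  assumes n: "n \<ge> 2" "even n"
  shows "newton_polynomial_z n =
    (\<Sum>p=0..n. of_nat (bnum n p) * (-1) powi (int (n div 2) - int p) * fls_X powi (int (n div 2) - int p))"
proof -
  let ?W = "weight n ` {M. perfect_matching n M}"
  let ?z = "\<lambda>p. int (n div 2) - int p"
  let ?t = "\<lambda>k. of_nat (num_matchings n (k, 0)) * (-1) powi k * fls_X powi k :: rat fls"
  have fin: "finite ?W" by (rule finite_imageI[OF finite_perfect_matchings])
  have "newton_polynomial_z n = (\<Sum>(a, b)\<in>?W. if b = 0 then ?t a else 0)"
    unfolding newton_polynomial_z_def newton_polynomial_def fls_nth_sum
    by (rule sum.cong) (auto simp: newton_term_nth_0 simp del: fls_times_nth fls_X_power_int)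
  \<comment> \<open>Weights in the new range that do not occur have matching number 0; occurring
    weights outside it have nonzero w-weight.\<close>
  also have "\<dots> = (\<Sum>(a, b)\<in>(\<lambda>p. (?z p, 0 :: int)) ` {0..n}. if b = 0 then ?t a else 0)"
  proof (rule sum.mono_neutral_cong[OF _ fin])
    fix k assume "k \<in> (\<lambda>p. (?z p, 0 :: int)) ` {0..n} - ?W"
    then obtain p where p: "k = (?z p, 0)" "(?z p, 0) \<notin> ?W" by auto
    then have "{M. perfect_matching n M \<and> weight n M = (?z p, 0)} = {}"
      by (auto simp: image_iff)
    then show "(case k of (a, b) \<Rightarrow> if b = 0 then ?t a else 0) = 0"
      by (simp only: p num_matchings_def card.empty of_nat_0 mult_zero_left case_prod_conv if_cancel)
  next
    fix k assume k: "k \<in> ?W - (\<lambda>p. (?z p, 0 :: int)) ` {0..n}"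
    then obtain a b M where "k = (a, b)" "perfect_matching n M" "weight n M = (a, b)"
      by (metis (mono_tags, lifting) DiffD1 imageE mem_Collect_eq surj_pair)
    then show "(case k of (a, b) \<Rightarrow> if b = 0 then ?t a else 0) = 0"
      using z_weight_range[OF n, of M a] k by auto
  qed auto
  also have "\<dots> = (\<Sum>p=0..n. ?t (?z p))"
    by (subst sum.reindex) (auto simp: inj_on_def)
  finally show ?thesis by (simp add: bnum_def)
qed

theorem mainTheorem4:
  fixes n :: nat
  assumes "n \<ge> 2" and "even n"
  shows "newton_polynomial_z n =
           (-1) ^ (n div 2) *
           (fls_X powi (- int (n div 2)) *
             (\<Sum>p=0..n. (-1) ^ p * fls_X ^ p * of_nat (bnum n p)))
         \<and> newton_polynomial_z n =
           (-1) ^ (n div 2) *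
           (fls_X powi (- int (n div 2)) *
             (\<Sum>p=0..n. (-1) ^ p * fls_X ^ p * fls_const (\<Sum>q=0..p. bnum_term n p q)))"
proof -
  let ?f = "\<lambda>k. of_nat (bnum n k) * (-1) powi (int (n div 2) - int k)
    * fls_X powi (int (n div 2) - int k) :: rat fls"
  \<comment> \<open>Reversal turns the exponent \<open>n / 2 - p\<close> of z into
    \<open>p - n / 2\<close>; the symmetry of \<open>bnum\<close> then restores the coefficient with
    index \<open>p\<close>.\<close>
  have "newton_polynomial_z n = (\<Sum>p=0..n. ?f (n - p))"
    unfolding newton_polynomial_z_eq_sum[OF assms] by (rule sum.atLeastAtMost_rev[of _ 0 n, simplified])
  also have "\<dots> = (\<Sum>p=0..n. (-1) ^ (n div 2) * (fls_X powi (- int (n div 2)) *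
      ((-1) ^ p * fls_X ^ p * of_nat (bnum n p))))"
  proof (rule sum.cong[OF refl])
    fix p assume "p \<in> {0..n}"
    then have p: "p \<le> n" by simp
    have e: "int (n div 2) - int (n - p) = - int (n div 2) + int p"
      using p assms(2) by (auto elim!: evenE)
    \<comment> \<open>The global sign is the part of \<open>(-1)\<close> to the power
      \<open>p - n / 2\<close> that does not depend on \<open>p\<close>.\<close>
    have sgn: "(-1 :: rat fls) powi (- int (n div 2)) = (-1) ^ (n div 2)"
      by (simp add: power_int_minus flip: power_inverse)
    show "?f (n - p) = (-1) ^ (n div 2) * (fls_X powi (- int (n div 2)) *
      ((-1) ^ p * fls_X ^ p * of_nat (bnum n p)))"
      unfolding bnum_symmetric[OF assms p] e
      by (simp add: power_int_add sgn del: fls_X_power_int uminus_add_conv_diff)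
  qed
  also have "\<dots> = (-1) ^ (n div 2) * (fls_X powi (- int (n div 2)) *
      (\<Sum>p=0..n. (-1) ^ p * fls_X ^ p * of_nat (bnum n p)))"
    by (simp only: sum_distrib_left)
  finally have 1: "newton_polynomial_z n = \<dots>" .
  have "(of_nat (bnum n p) :: rat fls) = fls_const (\<Sum>q=0..p. bnum_term n p q)" if "p \<in> {0..n}" for p
    using that of_nat_bnum[OF assms] by (simp add: fls_of_nat)
  then have "(\<Sum>p=0..n. (-1) ^ p * fls_X ^ p * of_nat (bnum n p)) =
      (\<Sum>p=0..n. (-1) ^ p * fls_X ^ p * fls_const (\<Sum>q=0..p. bnum_term n p q))"
    by (intro sum.cong) auto
  then show ?thesis using 1 by metis
qed

end
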